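(* Let $n\ge 1$ and let $\mu$ be any Borel probability measure on $\mathbb{R}^n$. Then there exists a set $X\subset \mathbb{R}^n$ of $n+1$ points such that, for any quadratic polynomial $P$ in $n$ real variables satisfying $P(x)\ge 0$ for every $x\in X$, $$\mu\{x\in\mathbb{R}^n : P(x)\ge 0\}\ \ge\ \frac{2}{(n+1)(n+2)}.$$
   Context: A quadratic polynomial in $n$ variables means a polynomial with real coefficients of total degree at most $2$. *)

theory Defs
  imports "HOL-Probability.Probability"
begin

definition monomial_fun :: "('n::finite \<Rightarrow> nat) \<Rightarrow> real ^ 'n \<Rightarrow> real" where
  "monomial_fun \<alpha> x = (\<Prod>i\<in>UNIV. (x $ i) ^ \<alpha> i)"

(* The index set is finite because the index type is; see finite_multi_indices below. *)
definition polynomial_of_degree_le :: "nat \<Rightarrow> (real ^ 'n::finite \<Rightarrow> real) \<Rightarrow> bool" where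
  "polynomial_of_degree_le d P \<longleftrightarrow>
     (\<exists>c :: ('n \<Rightarrow> nat) \<Rightarrow> real.
        \<forall>x. P x = (\<Sum>\<alpha> | (\<Sum>i\<in>UNIV. \<alpha> i) \<le> d. c \<alpha> * monomial_fun \<alpha> x))"

definition quadratic_polynomial :: "(real ^ 'n::finite \<Rightarrow> real) \<Rightarrow> bool" where
  "quadratic_polynomial P \<longleftrightarrow> polynomial_of_degree_le 2 P"

lemma finite_multi_indices: "finite {\<alpha> :: 'n::finite \<Rightarrow> nat. (\<Sum>i\<in>UNIV. \<alpha> i) \<le> d}"
proof (rule finite_subset)
  show "{\<alpha> :: 'n \<Rightarrow> nat. (\<Sum>i\<in>UNIV. \<alpha> i) \<le> d} \<subseteq> Pi\<^sub>E UNIV (\<lambda>_. {..d})"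
  proof
    fix \<alpha> :: "'n \<Rightarrow> nat"
    assume a: "\<alpha> \<in> {\<alpha>. (\<Sum>i\<in>UNIV. \<alpha> i) \<le> d}"
    have "\<alpha> i \<le> d" for i
      using a member_le_sum[of i UNIV \<alpha>] by (auto intro: order_trans)
    then show "\<alpha> \<in> Pi\<^sub>E UNIV (\<lambda>_. {..d})" by auto
  qed
  show "finite (Pi\<^sub>E (UNIV :: 'n set) (\<lambda>_. {..d}))"
    by (intro finite_PiE) auto
qed

end

theory Submission
  imports Defs
begin

text \<open>Let $N = {n+2 \choose 2} - 1$ be the number of nonconstant monomials of degree at most 2.
  A centerpoint $c$ in $R^N$ of the image of the measure under the Veronese map is a linear functional
  on quadratic polynomials which can be nonnegative on $P$ only if the set where $P \geq 0$ has measure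
  at least $1/(N+1)$. Since $c$ lies in the convex hull of the Veronese image, the functional is given
  by a positive semidefinite matrix of size $n+1$ with corner entry 1. Factoring this matrix so that
  all $n+1$ rank-one terms have the same corner entry exhibits the functional as the average of $P$
  over $n+1$ points, and these points form the set $X$.\<close>

section \<open>Centerpoints\<close>

text \<open>Union bound: each complement has probability below \<open>1 / m\<close> and there are at
  most \<open>m\<close> of them, so together they cannot cover the space.\<close>

lemma (in prob_space) common_point_of_large_events:
  assumes "finite \<B>" and "\<And>B. B \<in> \<B> \<Longrightarrow> B \<in> events"
    and large: "\<And>B. B \<in> \<B> \<Longrightarrow> prob B > 1 - 1 / real m" and "card \<B> \<le> m"
  shows "\<exists>x\<in>space M. \<forall>B\<in>\<B>. x \<in> B"
proof (cases "\<B> = {}")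
  case True
  then show ?thesis using not_empty by auto
next
  case False
  then have "card \<B> > 0" using assms(1) by (simp add: card_gt_0_iff)
  then have m: "real m > 0" using assms(4) by simp
  have "prob (\<Union>B\<in>\<B>. space M - B) \<le> (\<Sum>B\<in>\<B>. prob (space M - B))"
    using assms(1,2) by (intro finite_measure_subadditive_finite) auto
  also have "\<dots> < (\<Sum>B\<in>\<B>. 1 / real m)"
  proof (rule sum_strict_mono)
    show "prob (space M - B) < 1 / real m" if "B \<in> \<B>" for B
      using large[OF that] prob_compl[OF assms(2)[OF that]] by linarith
  qed (use assms(1) False in auto)
  also have "\<dots> \<le> 1" using assms(4) m by (simp add: field_simps)
  finally have "(\<Union>B\<in>\<B>. space M - B) \<noteq> space M" using prob_space by auto
  then show ?thesis by auto
qed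

text \<open>Taking convex hulls of images of compact sets instead of half-spaces makes the Helly family
  consist of compact sets, so that finite intersections suffice.\<close>

lemma centerpoint:
  fixes M :: "'a::euclidean_space measure" and v :: "'a \<Rightarrow> 'b::euclidean_space"
  assumes "prob_space M" and sets: "sets M = sets borel" and v: "continuous_on UNIV v"
  shows "\<exists>c. \<forall>B. compact B \<and> measure M B > 1 - 1 / (real DIM('b) + 1)
    \<longrightarrow> c \<in> convex hull (v ` B)"
proof -
  interpret prob_space M by fact
  define \<C> where "\<C> = {B. compact B \<and> measure M B > 1 - 1 / real (DIM('b) + 1)}"
  define \<F> where "\<F> = (\<lambda>B. convex hull (v ` B)) ` \<C>"
  have small: "\<Inter>\<G> \<noteq> {}" if \<G>: "\<G> \<subseteq> \<F>" "finite \<G>" "card \<G> \<le> DIM('b) + 1" for \<G>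
  proof -
    \<comment> \<open>Distinct compact sets may have the same hull. Choosing one preimage per hull
      carries the cardinality bound over to \<open>\<B>\<close>.\<close>
    obtain \<B> where "\<B> \<subseteq> \<C>" and inj: "inj_on (\<lambda>B. convex hull (v ` B)) \<B>"
      and \<G>_eq: "\<G> = (\<lambda>B. convex hull (v ` B)) ` \<B>"
      using \<G>(1) unfolding \<F>_def subset_image_inj by blast
    then have \<B>: "\<B> \<subseteq> \<C>" "finite \<B>" "card \<B> \<le> DIM('b) + 1"
      using \<G>(2,3) by (simp_all add: finite_image_iff card_image)
    have "\<exists>x\<in>space M. \<forall>B\<in>\<B>. x \<in> B"
    proof (rule common_point_of_large_events[OF \<B>(2) _ _ \<B>(3)])
      show "B \<in> events" if "B \<in> \<B>" for B
        using that \<B> sets unfolding \<C>_def by (auto intro: borel_compact)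
      show "prob B > 1 - 1 / real (DIM('b) + 1)" if "B \<in> \<B>" for B
        using that \<B> unfolding \<C>_def by auto
    qed
    then obtain x where "\<forall>B\<in>\<B>. x \<in> B" by auto
    then have "v x \<in> \<Inter>\<G>" using \<G>_eq by (auto intro: hull_inc)
    then show ?thesis by auto
  qed
  have fin: "\<Inter>\<G> \<noteq> {}" if "\<G> \<subseteq> \<F>" "finite \<G>" for \<G>
  proof (cases "card \<G> \<le> DIM('b) + 1")
    case False
    \<comment> \<open>Helly's theorem applies only to families of at least
      \<open>DIM('b) + 1\<close> sets; smaller families are covered directly by
      \<open>small\<close>.\<close>
    show ?thesis
    proof (rule Helly)
      show "DIM('b) + 1 \<le> card \<G>" using False by simp
      show "\<forall>S\<in>\<G>. convex S" using that by (auto simp: \<F>_def)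
      show "\<Inter>T \<noteq> {}" if "T \<subseteq> \<G>" "card T = DIM('b) + 1" for T
        using small[of T] that \<open>\<G> \<subseteq> \<F>\<close> by (auto intro: finite_subset[OF _ \<open>finite \<G>\<close>])
    qed
  qed (use small that in blast)
  have comp: "compact S" if "S \<in> \<F>" for S
    using that continuous_on_subset[OF v subset_UNIV] unfolding \<F>_def \<C>_def
    by (auto intro: compact_convex_hull compact_continuous_image)
  have "\<Inter>\<F> \<noteq> {}" by (rule compact_fip_Heine_Borel) (fact comp, use fin in blast)
  then obtain c where "c \<in> \<Inter>\<F>" by auto
  then show ?thesis unfolding \<F>_def \<C>_def by (auto simp: add.commute)
qed

text \<open>Continuity from below along an exhaustion of the open set where \<open>f\<close> is
  negative. The uniform gap \<open>\<epsilon>\<close> places the Veronese image of \<open>B\<close>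
  in a closed half-space when \<open>f\<close> is a quadratic polynomial.\<close>

lemma compact_subset_of_neg:
  fixes M :: "'a::euclidean_space measure" and f :: "'a \<Rightarrow> real"
  assumes "prob_space M" and sets: "sets M = sets borel" and f: "continuous_on UNIV f"
    and large: "measure M {x. f x < 0} > t"
  shows "\<exists>B \<epsilon>. compact B \<and> measure M B > t \<and> \<epsilon> > 0 \<and> (\<forall>x\<in>B. f x \<le> - \<epsilon>)"
proof -
  interpret prob_space M by fact
  define B where "B k = {x. f x \<le> - 1 / real (Suc k)} \<inter> cball 0 (real k)" for k
  have comp: "compact (B k)" for k
    unfolding B_def
    by (intro closed_Int_compact compact_cball closed_Collect_le f continuous_intros)
  have "(\<lambda>k. prob (B k)) \<longlonglongrightarrow> prob (\<Union>k. B k)"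
  proof (rule finite_Lim_measure_incseq)
    show "range B \<subseteq> events" using comp sets by (auto intro: borel_compact)
    show "incseq B"
    proof (rule incseq_SucI)
      fix k
      have "1 / real (Suc (Suc k)) \<le> 1 / real (Suc k)" by (intro divide_left_mono) auto
      then show "B k \<subseteq> B (Suc k)" unfolding B_def by auto
    qed
  qed
  moreover have "(\<Union>k. B k) = {x. f x < 0}"
  proof
    show "(\<Union>k. B k) \<subseteq> {x. f x < 0}"
    proof
      fix x assume "x \<in> (\<Union>k. B k)"
      then obtain k where k: "f x \<le> - 1 / real (Suc k)" unfolding B_def by auto
      also have "- 1 / real (Suc k) < 0" by simp
      finally show "x \<in> {x. f x < 0}" by simp
    qed
    show "{x. f x < 0} \<subseteq> (\<Union>k. B k)"
    proof
      fix x assume "x \<in> {x. f x < 0}"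
      then obtain k where k: "1 / real (Suc k) < - f x"
        using reals_Archimedean[of "- f x"] by (auto simp: inverse_eq_divide)
      obtain l where l: "norm x \<le> real l" using real_arch_simple by blast
      \<comment> \<open>Both conditions defining \<open>B\<close> weaken as the index grows, so the
        larger index meets both.\<close>
      define m where "m = max k l"
      have "1 / real (Suc m) \<le> 1 / real (Suc k)" unfolding m_def by (intro divide_left_mono) auto
      then have "x \<in> B m" using k l unfolding B_def m_def by (auto simp: le_max_iff_disj)
      then show "x \<in> (\<Union>k. B k)" by blast
    qed
  qed
  ultimately have "eventually (\<lambda>k. prob (B k) > t) sequentially"
    using large by (simp add: order_tendstoD)
  then obtain k where "prob (B k) > t"
    by (auto simp: eventually_sequentially)
  then show ?thesis
    using comp[of k] by (intro exI[of _ "B k"] exI[of _ "1 / real (Suc k)"]) (auto simp: B_def)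
qed

section \<open>Equal-weight quadrature for quadratic forms\<close>

text \<open>Caratheodory's theorem over a fixed finite index type, padded with zero weights at an
  arbitrary point of \<open>A\<close>.\<close>

lemma convex_hull_image_indexed:
  fixes f :: "'a \<Rightarrow> 'b::euclidean_space"
  assumes "y \<in> convex hull (f ` A)" and card: "DIM('b) + 1 \<le> CARD('k::finite)"
  shows "\<exists>w x. (\<forall>k::'k. w k \<ge> 0 \<and> x k \<in> A) \<and> sum w UNIV = 1 \<and> y = (\<Sum>k\<in>UNIV. w k *\<^sub>R f (x k))"
proof -
  obtain S u where S: "finite S" "S \<subseteq> f ` A" "card S \<le> DIM('b) + 1"
    and u: "\<forall>s\<in>S. 0 \<le> u s" "sum u S = 1" "(\<Sum>s\<in>S. u s *\<^sub>R s) = y"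
    using assms(1) unfolding convex_hull_caratheodory by blast
  obtain e :: "'b \<Rightarrow> 'k" where e: "inj_on e S"
    using card_le_inj[OF S(1), of "UNIV :: 'k set"] S(3) card by auto
  have "\<forall>s\<in>S. \<exists>a. a \<in> A \<and> f a = s" using S(2) by auto
  then obtain g where g: "\<And>s. s \<in> S \<Longrightarrow> g s \<in> A \<and> f (g s) = s"
    by (auto dest!: bchoice)
  have "S \<noteq> {}" using u(2) by auto
  then obtain a where "a \<in> A" using S(2) by auto
  define w where "w k = (if k \<in> e ` S then u (inv_into S e k) else 0)" for k
  define x where "x k = (if k \<in> e ` S then g (inv_into S e k) else a)" for k
  have 1: "w k \<ge> 0 \<and> x k \<in> A" for k
    using u(1) g \<open>a \<in> A\<close> e unfolding w_def x_def by auto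
  have 2: "sum w UNIV = 1"
  proof -
    have "sum w UNIV = sum w (e ` S)" by (rule sum.mono_neutral_right) (auto simp: w_def)
    also have "\<dots> = sum u S" using e by (simp add: sum.reindex w_def)
    finally show ?thesis using u by simp
  qed
  have "(\<Sum>k\<in>UNIV. w k *\<^sub>R f (x k)) = (\<Sum>k\<in>e ` S. w k *\<^sub>R f (x k))"
    by (rule sum.mono_neutral_right) (auto simp: w_def)
  also have "\<dots> = (\<Sum>s\<in>S. u s *\<^sub>R s)"
    using e g by (simp add: sum.reindex w_def x_def)
  finally show ?thesis using 1 2 u by metis
qed

text \<open>The second moments of the weighted points are the Gram matrix of the rows of the coefficient
  matrix. These rows can be moved isometrically into a space of dimension \<^term>\<open>CARD('m)\<close>, and a
  rotation there makes the distinguished row constant, which forces equal weights.\<close>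

lemma equal_weight_second_moments:
  fixes a :: "'k::finite \<Rightarrow> real ^ 'm::finite"
  assumes w: "\<And>k. w k \<ge> 0" "sum w UNIV = 1" and a: "\<And>k. a k $ i\<^sub>0 = 1"
  shows "\<exists>b :: 'm \<Rightarrow> real ^ 'm. (\<forall>k. b k $ i\<^sub>0 = 1) \<and>
    (\<forall>p q. (\<Sum>k\<in>UNIV. w k * (a k $ p * a k $ q)) =
      (\<Sum>k\<in>UNIV. b k $ p * b k $ q) / real CARD('m))"
proof -
  define s where "s = sqrt (real CARD('m))"
  have s: "s > 0" "s * s = real CARD('m)" unfolding s_def by auto
  \<comment> \<open>Splitting each weight into two square roots turns the weighted second moments
    into plain inner products.\<close>
  define r :: "'m \<Rightarrow> real ^ 'k" where "r p = (\<chi> k. sqrt (w k) * a k $ p)" for p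
  have r: "r p \<bullet> r q = (\<Sum>k\<in>UNIV. w k * (a k $ p * a k $ q))" for p q
    unfolding inner_vec_def r_def
  proof (rule sum.cong)
    fix k
    have "sqrt (w k) * sqrt (w k) = w k" using w(1)[of k] by simp
    then show "(\<chi> k. sqrt (w k) * a k $ p) $ k \<bullet> (\<chi> k. sqrt (w k) * a k $ q) $ k
        = w k * (a k $ p * a k $ q)"
      by (simp add: algebra_simps)
  qed simp
  have "dim (span (range r)) \<le> dim (UNIV :: (real ^ 'm) set)"
    using dim_le_card'[of "range r"] card_image_le[of "UNIV :: 'm set" r] by simp
  then obtain f :: "real ^ 'k \<Rightarrow> real ^ 'm"
    where f: "linear f" "\<And>x. x \<in> span (range r) \<Longrightarrow> norm (f x) = norm x"
    using isometry_subset_subspace[of "span (range r)" "UNIV :: (real ^ 'm) set"]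
    by (metis subspace_span subspace_UNIV)
  \<comment> \<open>Polarization: a linear map preserving norms on the span preserves inner products
    there.\<close>
  have inner_f: "f (r p) \<bullet> f (r q) = r p \<bullet> r q" for p q
  proof -
    have "norm (f (r p + r q)) = norm (r p + r q)" "norm (f (r p)) = norm (r p)"
      "norm (f (r q)) = norm (r q)"
      by (intro f(2) span_add span_base rangeI)+
    then show ?thesis by (simp add: dot_norm linear_add[OF f(1)])
  qed
  define c :: "real ^ 'm" where "c = (\<chi> k. 1 / s)"
  have "c \<bullet> c = 1" unfolding c_def inner_vec_def using s by (simp add: field_simps)
  moreover have "f (r i\<^sub>0) \<bullet> f (r i\<^sub>0) = 1" unfolding inner_f r using a w by simp
  ultimately have "norm (f (r i\<^sub>0)) = 1" "norm c = 1" by (auto simp: norm_eq_1)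
  then obtain g where g: "orthogonal_transformation g" "g (f (r i\<^sub>0)) = c"
    by (rule orthogonal_transformation_exists_1)
  \<comment> \<open>The factor \<open>s\<close> rescales the constant row \<open>c\<close> to ones
    and multiplies the Gram matrix by \<open>s * s\<close>, which the division by
    \<open>CARD('m)\<close> undoes.\<close>
  define b :: "'m \<Rightarrow> real ^ 'm" where "b k = (\<chi> p. s * g (f (r p)) $ k)" for k
  have "b k $ i\<^sub>0 = 1" for k unfolding b_def using g(2) s by (simp add: c_def)
  moreover have "(\<Sum>k\<in>UNIV. w k * (a k $ p * a k $ q)) =
      (\<Sum>k\<in>UNIV. b k $ p * b k $ q) / real CARD('m)" for p q
  proof -
    have "(\<Sum>k\<in>UNIV. b k $ p * b k $ q) = (\<Sum>k\<in>UNIV. (s * s) * (g (f (r p)) $ k * g (f (r q)) $ k))"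
      unfolding b_def by (simp add: algebra_simps)
    also have "\<dots> = real CARD('m) * (g (f (r p)) \<bullet> g (f (r q)))"
      by (simp add: s sum_distrib_left[symmetric] inner_vec_def)
    also have "g (f (r p)) \<bullet> g (f (r q)) = r p \<bullet> r q"
      using g(1) inner_f by (simp add: orthogonal_transformation_def)
    finally show ?thesis using r by simp
  qed
  ultimately show ?thesis by blast
qed

section \<open>The quadratic Veronese map\<close>

text \<open>Unordered pairs from \<^typ>\<open>'n option\<close>, repetition allowed, where \<^term>\<open>None\<close> stands for the
  homogenizing coordinate. Removing \<^term>\<open>{None}\<close> discards the constant monomial, so that the
  dimension is exactly one less than the number of monomials.\<close>

typedef (overloaded) 'n quad_index =
  "{B :: 'n::finite option set. (card B = 1 \<or> card B = 2) \<and> B \<noteq> {None}}"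
  by (rule exI[of _ "{Some undefined}"]) simp

instance quad_index :: (finite) finite
proof
  show "finite (UNIV :: 'a quad_index set)"
    unfolding type_definition.univ[OF type_definition_quad_index] by (intro finite_imageI) auto
qed

text \<open>Restoring \<open>{None}\<close> gives all one- and two-element subsets of a set of size
  n+1, hence (n+1) + (n+1 choose 2) = (n+2 choose 2).\<close>

lemma card_quad_index:
  "2 * (real CARD('n::finite quad_index) + 1) = (real CARD('n) + 1) * (real CARD('n) + 2)"
proof -
  let ?S = "\<lambda>k. {B :: 'n option set. B \<subseteq> UNIV \<and> card B = k}"
  let ?T = "{B :: 'n option set. (card B = 1 \<or> card B = 2) \<and> B \<noteq> {None}}"
  have "CARD('n quad_index) = card ?T"
    by (rule type_definition.card[OF type_definition_quad_index])
  moreover have "card (insert {None} ?T) = Suc (card ?T)"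
    by (subst card_insert_disjoint) auto
  moreover have "insert {None} ?T = ?S 1 \<union> ?S 2" by auto
  moreover have "card (?S 1 \<union> ?S 2) = card (?S 1) + card (?S 2)"
    by (subst card_Un_disjoint) auto
  moreover have "card (?S k) = (CARD('n) + 1) choose k" for k
    using n_subsets[of "UNIV :: 'n option set" k] by (simp add: card_UNIV_option)
  ultimately have "CARD('n quad_index) + 1 = (CARD('n) + 1) + ((CARD('n) + 1) choose 2)"
    by (metis Suc_eq_plus1 choose_one)
  moreover have "2 * ((CARD('n) + 1) choose 2) = (CARD('n) + 1) * CARD('n)"
    by (simp add: choose_two)
  ultimately have "2 * (CARD('n quad_index) + 1) = (CARD('n) + 1) * (CARD('n) + 2)"
    by (simp add: algebra_simps)
  then show ?thesis by (simp add: algebra_simps flip: of_nat_eq_iff[where 'a = real])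
qed

text \<open>With the extra coordinate 1, the products of two coordinates are exactly the monomials
  of degree at most 2.\<close>

definition homog :: "real ^ 'n::finite \<Rightarrow> real ^ 'n option" where
  "homog x = (\<chi> p. case p of None \<Rightarrow> 1 | Some i \<Rightarrow> x $ i)"

lemma homog_simps [simp]: "homog x $ None = 1" "homog x $ Some i = x $ i"
  by (simp_all add: homog_def)

lemma continuous_homog [continuous_intros]: "continuous_on UNIV (\<lambda>x. homog x $ p)"
  by (cases p) (auto intro!: continuous_intros)

text \<open>The exponent is 2 for a singleton and 1 for a proper pair.\<close>

definition veronese :: "real ^ 'n::finite \<Rightarrow> real ^ 'n quad_index" where
  "veronese x = (\<chi> B. \<Prod>p\<in>Rep_quad_index B. (homog x $ p) ^ (3 - card (Rep_quad_index B)))"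

lemma continuous_veronese: "continuous_on UNIV (veronese :: real ^ 'n::finite \<Rightarrow> _)"
  unfolding veronese_def by (intro continuous_intros)

text \<open>The choice of \<open>p\<close> and \<open>q\<close> is uniform in \<open>x\<close>, so
  identities between second moments transfer to each Veronese coordinate.\<close>

lemma veronese_product:
  "\<exists>p q. \<forall>x. veronese x $ B = homog x $ p * homog x $ q"
proof -
  consider "card (Rep_quad_index B) = 1" | "card (Rep_quad_index B) = 2"
    using Rep_quad_index[of B] by auto
  then show ?thesis
  proof cases
    case 1
    then obtain p where "Rep_quad_index B = {p}" by (auto simp: card_1_singleton_iff)
    then show ?thesis by (intro exI[of _ p]) (simp add: veronese_def power2_eq_square)
  next
    case 2
    then obtain p q where "Rep_quad_index B = {p, q}" "p \<noteq> q" by (auto simp: card_2_iff)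
    then show ?thesis by (intro exI[of _ p] exI[of _ q]) (simp add: veronese_def)
  qed
qed

text \<open>The constant \<open>a\<close> accounts for the discarded monomial, the case where both
  indices are \<open>None\<close>; every other product is itself a coordinate.\<close>

lemma product_affine_veronese:
  "\<exists>a b. \<forall>x :: real ^ 'n::finite. homog x $ p * homog x $ q = a + b \<bullet> veronese x"
proof (cases "p = None \<and> q = None")
  case True
  then show ?thesis by (intro exI[of _ 1] exI[of _ 0]) simp
next
  case False
  then have "{p, q} \<in> {B. (card B = 1 \<or> card B = 2) \<and> B \<noteq> {None}}"
    by (auto simp: card_insert_if)
  then have R: "Rep_quad_index (Abs_quad_index {p, q}) = {p, q}"
    by (rule Abs_quad_index_inverse)
  have "homog x $ p * homog x $ q = veronese x $ Abs_quad_index {p, q}" for x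
  proof -
    have "veronese x $ Abs_quad_index {p, q} = (\<Prod>r\<in>{p, q}. homog x $ r ^ (3 - card {p, q}))"
      unfolding veronese_def by (simp add: R)
    then show ?thesis by (cases "p = q") (simp_all add: power2_eq_square)
  qed
  then show ?thesis
    by (intro exI[of _ 0] exI[of _ "axis (Abs_quad_index {p, q}) 1"])
      (simp add: inner_axis')
qed

text \<open>Split off one variable, or the homogenizing coordinate 1 if the exponent is zero. Two
  applications write a monomial of degree at most 2 as a product of two coordinates of
  \<open>homog x\<close>.\<close>

lemma monomial_fun_Suc:
  fixes \<alpha> :: "'n::finite \<Rightarrow> nat"
  assumes "(\<Sum>i\<in>UNIV. \<alpha> i) \<le> Suc d"
  shows "\<exists>p \<beta>. (\<Sum>i\<in>UNIV. \<beta> i) \<le> d \<and> (\<forall>x. monomial_fun \<alpha> x = homog x $ p * monomial_fun \<beta> x)"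
proof (cases "\<exists>i. \<alpha> i > 0")
  case False
  then show ?thesis by (intro exI[of _ None] exI[of _ \<alpha>]) simp
next
  case True
  then obtain i where i: "\<alpha> i > 0" by auto
  define \<beta> where "\<beta> = \<alpha>(i := \<alpha> i - 1)"
  have "(\<Sum>j\<in>UNIV. \<alpha> j) = \<alpha> i + (\<Sum>j\<in>UNIV - {i}. \<alpha> j)" by (rule sum.remove) simp_all
  moreover have "(\<Sum>j\<in>UNIV. \<beta> j) = \<beta> i + (\<Sum>j\<in>UNIV - {i}. \<beta> j)" by (rule sum.remove) simp_all
  moreover have "(\<Sum>j\<in>UNIV - {i}. \<beta> j) = (\<Sum>j\<in>UNIV - {i}. \<alpha> j)"
    by (rule sum.cong) (auto simp: \<beta>_def)
  ultimately have "(\<Sum>j\<in>UNIV. \<beta> j) \<le> d" using i assms by (simp add: \<beta>_def)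
  moreover have "monomial_fun \<alpha> x = homog x $ Some i * monomial_fun \<beta> x" for x
  proof -
    have "monomial_fun \<alpha> x = x $ i ^ \<alpha> i * (\<Prod>j\<in>UNIV - {i}. x $ j ^ \<alpha> j)"
      unfolding monomial_fun_def by (rule prod.remove) simp_all
    also have "(\<Prod>j\<in>UNIV - {i}. x $ j ^ \<alpha> j) = (\<Prod>j\<in>UNIV - {i}. x $ j ^ \<beta> j)"
      by (rule prod.cong) (auto simp: \<beta>_def)
    also have "x $ i ^ \<alpha> i = x $ i * x $ i ^ \<beta> i"
      using i by (simp add: \<beta>_def power_eq_if)
    also have "x $ i * x $ i ^ \<beta> i * (\<Prod>j\<in>UNIV - {i}. x $ j ^ \<beta> j) = x $ i * monomial_fun \<beta> x"
      unfolding monomial_fun_def by (subst prod.remove[of UNIV i]) simp_all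
    finally show ?thesis by simp
  qed
  ultimately show ?thesis by blast
qed

lemma quadratic_polynomial_affine_veronese:
  fixes P :: "real ^ 'n::finite \<Rightarrow> real"
  assumes "quadratic_polynomial P"
  shows "\<exists>a b. \<forall>x. P x = a + b \<bullet> veronese x"
proof -
  have "\<exists>a b. \<forall>x :: real ^ 'n. monomial_fun \<alpha> x = a + b \<bullet> veronese x"
    if "(\<Sum>i\<in>UNIV. \<alpha> i) \<le> 2" for \<alpha> :: "'n \<Rightarrow> nat"
  proof -
    obtain p \<beta> where 1: "(\<Sum>i\<in>UNIV. \<beta> i) \<le> 1" "\<And>x. monomial_fun \<alpha> x = homog x $ p * monomial_fun \<beta> x"
      using monomial_fun_Suc[of \<alpha> 1] \<open>sum \<alpha> UNIV \<le> 2\<close> by (auto simp: numeral_2_eq_2)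
    obtain q \<gamma> where 2: "(\<Sum>i\<in>UNIV. \<gamma> i) \<le> 0" "\<And>x. monomial_fun \<beta> x = homog x $ q * monomial_fun \<gamma> x"
      using monomial_fun_Suc[of \<beta> 0] 1(1) by auto
    have "monomial_fun \<gamma> x = 1" for x using 2(1) by (simp add: monomial_fun_def)
    then show ?thesis using product_affine_veronese[of p q] 1 2 by simp
  qed
  then obtain A B where AB:
    "\<And>\<alpha> x. (\<Sum>i\<in>UNIV. \<alpha> i) \<le> 2 \<Longrightarrow> monomial_fun \<alpha> x = A \<alpha> + B \<alpha> \<bullet> veronese (x :: real ^ 'n)"
    by metis
  obtain c where c: "\<And>x. P x = (\<Sum>\<alpha> | (\<Sum>i\<in>UNIV. \<alpha> i) \<le> 2. c \<alpha> * monomial_fun \<alpha> x)"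
    using assms unfolding quadratic_polynomial_def polynomial_of_degree_le_def by auto
  let ?I = "{\<alpha> :: 'n \<Rightarrow> nat. (\<Sum>i\<in>UNIV. \<alpha> i) \<le> 2}"
  have "P x = (\<Sum>\<alpha>\<in>?I. c \<alpha> * A \<alpha>) + (\<Sum>\<alpha>\<in>?I. c \<alpha> *\<^sub>R B \<alpha>) \<bullet> veronese x" for x
    unfolding c using AB
    by (simp add: inner_sum_left sum.distrib[symmetric] algebra_simps)
  then show ?thesis by blast
qed

text \<open>Veronese coordinates are second moments of homogenized points, so the weights can be
  equalized. Keeping the \<open>None\<close> entries equal to 1 ensures that the new vectors are
  again homogenized points.\<close>

lemma convex_hull_veronese_average:
  fixes c :: "real ^ 'n::finite quad_index"
  assumes "c \<in> convex hull (range veronese)"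
  shows "\<exists>x :: 'n option \<Rightarrow> real ^ 'n. c = (1 / (real CARD('n) + 1)) *\<^sub>R (\<Sum>k\<in>UNIV. veronese (x k))"
proof -
  \<comment> \<open>The \<open>option\<close> type supplies exactly the dimension plus one indices
    that Caratheodory's theorem requires.\<close>
  obtain w :: "'n quad_index option \<Rightarrow> real" and y where w: "\<And>k. w k \<ge> 0" "sum w UNIV = 1"
    and c: "c = (\<Sum>k\<in>UNIV. w k *\<^sub>R veronese (y k))"
    using convex_hull_image_indexed[OF assms, where 'k = "'n quad_index option"]
    by (auto simp: card_UNIV_option)
  obtain b :: "'n option \<Rightarrow> real ^ 'n option" where b: "\<And>k. b k $ None = 1"
    "\<And>p q. (\<Sum>k\<in>UNIV. w k * (homog (y k) $ p * homog (y k) $ q)) =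
      (\<Sum>k\<in>UNIV. b k $ p * b k $ q) / real CARD('n option)"
    using equal_weight_second_moments[of w "\<lambda>k. homog (y k)" None] w by auto
  define x :: "'n option \<Rightarrow> real ^ 'n" where "x k = (\<chi> i. b k $ Some i)" for k
  have x: "b k = homog (x k)" for k
    unfolding vec_eq_iff
  proof
    show "b k $ p = homog (x k) $ p" for p by (cases p) (auto simp: b x_def)
  qed
  have "c $ B = ((1 / (real CARD('n) + 1)) *\<^sub>R (\<Sum>k\<in>UNIV. veronese (x k))) $ B" for B
  proof -
    obtain p q where "\<And>x. veronese x $ B = homog x $ p * homog x $ q"
      using veronese_product by blast
    then show ?thesis unfolding c using b(2)[of p q] by (simp add: x card_UNIV_option add.commute)
  qed
  then show ?thesis by (auto simp: vec_eq_iff)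
qed

section \<open>Assembling the point set\<close>

lemma extend_to_card:
  assumes "finite (Y :: 'a set)" "card Y \<le> m" "infinite (UNIV :: 'a set)"
  shows "\<exists>X. finite X \<and> card X = m \<and> Y \<subseteq> X"
proof -
  obtain Z where "finite Z" "card Z = m - card Y" "Z \<subseteq> - Y"
    using infinite_arbitrarily_large[of "- Y" "m - card Y"] assms by (auto simp: Compl_eq_Diff_UNIV)
  moreover from this have "Y \<inter> Z = {}" by auto
  ultimately show ?thesis
    using assms by (intro exI[of _ "Y \<union> Z"]) (auto simp: card_Un_disjoint)
qed

theorem theorem1:
  fixes \<mu> :: "(real ^ 'n::finite) measure"
  assumes "prob_space \<mu>" and "sets \<mu> = sets borel"
  shows "\<exists>X :: (real ^ 'n) set. finite X \<and> card X = CARD('n) + 1 \<and>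
    (\<forall>P. quadratic_polynomial P \<and> (\<forall>x\<in>X. P x \<ge> 0) \<longrightarrow>
      measure \<mu> {x. P x \<ge> 0} \<ge> 2 / ((real CARD('n) + 1) * (real CARD('n) + 2)))"
proof -
  interpret prob_space \<mu> by fact
  define t where "t = 1 - 1 / (real CARD('n quad_index) + 1)"
  have t: "2 / ((real CARD('n) + 1) * (real CARD('n) + 2)) = 1 - t"
    unfolding t_def card_quad_index[symmetric] by (simp add: field_simps)
  have space: "space \<mu> = UNIV" using sets_eq_imp_space_eq[OF assms(2)] by simp
  obtain c :: "real ^ 'n quad_index" where
    c: "\<And>B. compact B \<Longrightarrow> measure \<mu> B > t \<Longrightarrow> c \<in> convex hull (veronese ` B)"
    using centerpoint[OF assms continuous_veronese] unfolding t_def by auto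
  \<comment> \<open>The constant function -1 is negative everywhere, so the approximation lemma
    yields a compact set of measure above \<open>t\<close>. This places \<open>c\<close> in the hull
    of the full Veronese image.\<close>
  have "t < 1" unfolding t_def by simp
  then have "measure \<mu> {x. (-1::real) < 0} > t" using prob_space space by simp
  from compact_subset_of_neg[OF assms _ this] have "\<exists>B. compact B \<and> measure \<mu> B > t"
    by auto
  then obtain B where "c \<in> convex hull (veronese ` B)" using c by blast
  moreover have "convex hull (veronese ` B) \<subseteq> convex hull (range veronese)"
    by (intro hull_mono image_mono subset_UNIV)
  ultimately have "c \<in> convex hull (range veronese)" by blast
  then obtain x :: "'n option \<Rightarrow> real ^ 'n"
    where x: "c = (1 / (real CARD('n) + 1)) *\<^sub>R (\<Sum>k\<in>UNIV. veronese (x k))"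
    using convex_hull_veronese_average by blast
  \<comment> \<open>The points \<open>x k\<close> may coincide, so their range is enlarged to
    exactly n+1 points; nonnegativity on the larger set still covers every
    \<open>x k\<close>.\<close>
  have "card (range x) \<le> CARD('n) + 1"
    using card_image_le[of UNIV x] by (simp add: card_UNIV_option)
  moreover have "infinite (UNIV :: (real ^ 'n) set)"
    using not_bounded_UNIV finite_imp_bounded by blast
  ultimately obtain X where X: "finite X" "card X = CARD('n) + 1" "range x \<subseteq> X"
    using extend_to_card[of "range x" "CARD('n) + 1"] by auto
  have "measure \<mu> {x. P x \<ge> 0} \<ge> 1 - t"
    if P: "quadratic_polynomial P" and nonneg: "\<forall>x\<in>X. P x \<ge> 0" for P
  proof (rule ccontr)
    assume less: "\<not> ?thesis"
    obtain a b where ab: "\<And>x. P x = a + b \<bullet> veronese x"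
      using quadratic_polynomial_affine_veronese[OF P] by blast
    have cont: "continuous_on UNIV P"
      unfolding ab by (intro continuous_intros continuous_veronese)
    have "{x. P x \<ge> 0} \<in> events"
      unfolding assms(2) by (intro borel_closed closed_Collect_le cont continuous_intros)
    then have "measure \<mu> (space \<mu> - {x. P x \<ge> 0}) = 1 - measure \<mu> {x. P x \<ge> 0}"
      by (rule prob_compl)
    moreover have "space \<mu> - {x. P x \<ge> 0} = {x. P x < 0}" using space by auto
    ultimately have "measure \<mu> {x. P x < 0} > t" using less by simp
    from compact_subset_of_neg[OF assms cont this]
    obtain B \<epsilon> where B: "compact B" "measure \<mu> B > t" "\<epsilon> > 0" "\<forall>x\<in>B. P x \<le> - \<epsilon>" by blast
    \<comment> \<open>The affine functional representing \<open>P\<close> is negative on this hull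
      and hence at \<open>c\<close>, but its value at \<open>c\<close> is the average of the
      nonnegative numbers \<open>P (x k)\<close>.\<close>
    have "convex hull (veronese ` B) \<subseteq> {z. b \<bullet> z \<le> - \<epsilon> - a}"
      using B(4) by (intro hull_minimal convex_halfspace_le) (auto simp: ab)
    then have "a + b \<bullet> c < 0" using c[OF B(1,2)] B(3) by auto
    moreover have "a + b \<bullet> c = (1 / (real CARD('n) + 1)) * (\<Sum>k\<in>UNIV. P (x k))"
      unfolding ab x
      by (simp add: inner_sum_right sum.distrib card_UNIV_option field_simps)
    moreover have "(\<Sum>k\<in>UNIV. P (x k)) \<ge> 0"
      using X(3) nonneg by (intro sum_nonneg) auto
    ultimately show False by (simp add: divide_less_0_iff)
  qed
  then show ?thesis using X t by auto
qed

end
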